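(* Let $\mathbb{F}$ be a subfield of $\mathbb{C}$, and let $A=\mathbb{F}a\oplus\mathbb{F}b$ be the commutative $\mathbb{F}$-algebra with basis $a,b$ and multiplication $a^2=a$, $ab=2b$, $b^2=b$, with specified generating set $\{a,b\}$ and the fusion law $\star$ on $\{0,1,2\}$ given by $$0\star 0=\{0,1\},\quad 1\star 1=\{1\},\quad 1\star 2=2\star 1=\{2\},\quad 2\star 2=\{2\},\quad 0\star 1=1\star 0=0\star 2=2\star 0=\varnothing.$$ Then, after scalar extension to $\mathbb{C}$, this axial algebra is the presentation $$D(-1),\qquad X=\{e_2,a_6\},\qquad\text{fusion law }F_{D3}.$$ That is, there is an isomorphism of $\mathbb{C}$-algebras $\mathbb{C}\otimes_{\mathbb{F}}A\to D(-1)$ carrying the generating set $\{a,b\}$ onto $\{e_2,a_6\}$, and the fusion law $\star$ coincides with the fusion law $F_{D3}$ at $\beta=-1$.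
   Context: Algebras are commutative and not necessarily associative. For $\beta\in\mathbb{C}$, $D(\beta)$ is the two-dimensional commutative $\mathbb{C}$-algebra with basis $e_1,e_2$ and multiplication $$e_1^2=e_1,\qquad e_1e_2=\beta e_2,\qquad e_2^2=e_2,$$ and $a_6=e_1+(1-2\beta)e_2\in D(\beta)$. A fusion law is a finite set $\mathcal{S}$ of scalars together with a symmetric map $\star$ assigning to each pair $\lambda,\mu\in\mathcal{S}$ a subset $\lambda\star\mu\subseteq\mathcal{S}$. $F_{D3}$ denotes a fusion law with eigenvalue set $\{1,1-\beta,0\}$ attached to the generating set $\{e_2,a_6\}$ of $D(\beta)$; at $\beta=-1$ it is the fusion law on $\{1,2,0\}$ with $1\star1=\{1\}$, $1\star 2=2\star 1=\{2\}$, $2\star 2=\{2\}$, $0\star 0=\{0,1\}$, and all other products empty. An axial algebra is specified here by its underlying algebra, its specified generating set of axes (idempotents $x$ whose left multiplication is diagonalizable with eigenvalues in $\mathcal{S}$ and whose eigenspaces $A_\lambda(x)$ satisfy $A_\lambda(x)A_\mu(x)\subseteq\bigoplus_{\nu\in\lambda\star\mu}A_\nu(x)$), and its fusion law. *)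

theory Defs
  imports Complex_Main "HOL-Algebra.Algebra"
begin

definition complex_field :: "complex ring" where
  "complex_field = \<lparr>carrier = UNIV, monoid.mult = (*), one = 1, ring.zero = 0, ring.add = (+)\<rparr>"

section \<open>Commutative, not necessarily associative algebras\<close>

text \<open>Algebras are carried by the library record for modules. This record extends the one for
  rings, so it has a field \<^const>\<open>one\<close>. Our algebras need not be unital, and that
  field is never used: nothing below depends on its value.\<close>

locale comm_nonassoc_algebra = field R + module R M
  for R (structure) and M (structure) +
  assumes mult_closed:
      "\<lbrakk>x \<in> carrier M; y \<in> carrier M\<rbrakk> \<Longrightarrow> x \<otimes>\<^bsub>M\<^esub> y \<in> carrier M"
    and mult_comm:
      "\<lbrakk>x \<in> carrier M; y \<in> carrier M\<rbrakk> \<Longrightarrow> x \<otimes>\<^bsub>M\<^esub> y = y \<otimes>\<^bsub>M\<^esub> x"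
    and mult_l_distr:
      "\<lbrakk>x \<in> carrier M; y \<in> carrier M; z \<in> carrier M\<rbrakk> \<Longrightarrow>
       (x \<oplus>\<^bsub>M\<^esub> y) \<otimes>\<^bsub>M\<^esub> z = (x \<otimes>\<^bsub>M\<^esub> z) \<oplus>\<^bsub>M\<^esub> (y \<otimes>\<^bsub>M\<^esub> z)"
    and mult_smult:
      "\<lbrakk>r \<in> carrier R; x \<in> carrier M; y \<in> carrier M\<rbrakk> \<Longrightarrow>
       (r \<odot>\<^bsub>M\<^esub> x) \<otimes>\<^bsub>M\<^esub> y = r \<odot>\<^bsub>M\<^esub> (x \<otimes>\<^bsub>M\<^esub> y)"

text \<open>\<open>(u, v)\<close> is a basis of the module \<open>M\<close> over \<open>R\<close>.\<close>

definition basis_pair :: "('k, 'r) ring_scheme \<Rightarrow> ('k, 'a, 'm) module_scheme \<Rightarrow> 'a \<Rightarrow> 'a \<Rightarrow> bool"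
  where "basis_pair R M u v \<longleftrightarrow>
    u \<in> carrier M \<and> v \<in> carrier M \<and>
    (\<forall>x \<in> carrier M. \<exists>!p. p \<in> carrier R \<times> carrier R \<and>
       x = (fst p \<odot>\<^bsub>M\<^esub> u) \<oplus>\<^bsub>M\<^esub> (snd p \<odot>\<^bsub>M\<^esub> v))"

definition nonassoc_subalgebra :: "('k, 'r) ring_scheme \<Rightarrow> ('k, 'a, 'm) module_scheme \<Rightarrow> 'a set \<Rightarrow> bool"
  where "nonassoc_subalgebra R M B \<longleftrightarrow>
    submodule B R M \<and> (\<forall>x \<in> B. \<forall>y \<in> B. x \<otimes>\<^bsub>M\<^esub> y \<in> B)"

definition generates :: "('k, 'r) ring_scheme \<Rightarrow> ('k, 'a, 'm) module_scheme \<Rightarrow> 'a set \<Rightarrow> bool"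
  where "generates R M S \<longleftrightarrow>
    S \<subseteq> carrier M \<and> (\<forall>B. nonassoc_subalgebra R M B \<and> S \<subseteq> B \<longrightarrow> B = carrier M)"

definition algebra_iso ::
    "('k, 'r) ring_scheme \<Rightarrow> ('k, 'a, 'm) module_scheme \<Rightarrow> ('k, 'b, 'n) module_scheme \<Rightarrow> ('a \<Rightarrow> 'b) \<Rightarrow> bool"
  where "algebra_iso R M N \<phi> \<longleftrightarrow>
    comm_nonassoc_algebra R M \<and> comm_nonassoc_algebra R N \<and>
    bij_betw \<phi> (carrier M) (carrier N) \<and>
    (\<forall>x \<in> carrier M. \<forall>y \<in> carrier M. \<phi> (x \<oplus>\<^bsub>M\<^esub> y) = \<phi> x \<oplus>\<^bsub>N\<^esub> \<phi> y) \<and>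
    (\<forall>r \<in> carrier R. \<forall>x \<in> carrier M. \<phi> (r \<odot>\<^bsub>M\<^esub> x) = r \<odot>\<^bsub>N\<^esub> \<phi> x) \<and>
    (\<forall>x \<in> carrier M. \<forall>y \<in> carrier M. \<phi> (x \<otimes>\<^bsub>M\<^esub> y) = \<phi> x \<otimes>\<^bsub>N\<^esub> \<phi> y)"

section \<open>Scalar extension\<close>

text \<open>For a field \<open>L\<close>, a subfield \<open>K\<close> of \<open>L\<close> and a \<open>K\<close>-algebra \<open>A\<close>, the tensor product
  of \<open>L\<close> and \<open>A\<close> over \<open>K\<close> is the free abelian group on the pairs \<open>(c, x)\<close> modulo the
  subgroup generated by the bilinearity and balancing relations.\<close>

definition tensor_relations ::
    "('k, 'r) ring_scheme \<Rightarrow> 'k set \<Rightarrow> ('k, 'a, 'm) module_scheme \<Rightarrow> ('k \<times> 'a \<Rightarrow>\<^sub>0 int) set"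
  where "tensor_relations L K A =
    {frag_of (c \<oplus>\<^bsub>L\<^esub> d, x) - frag_of (c, x) - frag_of (d, x) | c d x.
       c \<in> carrier L \<and> d \<in> carrier L \<and> x \<in> carrier A} \<union>
    {frag_of (c, x \<oplus>\<^bsub>A\<^esub> y) - frag_of (c, x) - frag_of (c, y) | c x y.
       c \<in> carrier L \<and> x \<in> carrier A \<and> y \<in> carrier A} \<union>
    {frag_of (c \<otimes>\<^bsub>L\<^esub> k, x) - frag_of (c, k \<odot>\<^bsub>A\<^esub> x) | c k x.
       c \<in> carrier L \<and> k \<in> K \<and> x \<in> carrier A}"

definition tensor_free ::
    "('k, 'r) ring_scheme \<Rightarrow> ('k, 'a, 'm) module_scheme \<Rightarrow> ('k \<times> 'a \<Rightarrow>\<^sub>0 int) monoid"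
  where "tensor_free L A = free_Abelian_group (carrier L \<times> carrier A)"

definition tensor_kernel ::
    "('k, 'r) ring_scheme \<Rightarrow> 'k set \<Rightarrow> ('k, 'a, 'm) module_scheme \<Rightarrow> ('k \<times> 'a \<Rightarrow>\<^sub>0 int) set"
  where "tensor_kernel L K A = generate (tensor_free L A) (tensor_relations L K A)"

definition tensor_group ::
    "('k, 'r) ring_scheme \<Rightarrow> 'k set \<Rightarrow> ('k, 'a, 'm) module_scheme \<Rightarrow> ('k \<times> 'a \<Rightarrow>\<^sub>0 int) set monoid"
  where "tensor_group L K A = tensor_free L A Mod tensor_kernel L K A"

definition tensor_class ::
    "('k, 'r) ring_scheme \<Rightarrow> 'k set \<Rightarrow> ('k, 'a, 'm) module_scheme \<Rightarrow>
     ('k \<times> 'a \<Rightarrow>\<^sub>0 int) \<Rightarrow> ('k \<times> 'a \<Rightarrow>\<^sub>0 int) set"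
  where "tensor_class L K A p = tensor_kernel L K A #>\<^bsub>tensor_free L A\<^esub> p"

definition pure_tensor ::
    "('k, 'r) ring_scheme \<Rightarrow> 'k set \<Rightarrow> ('k, 'a, 'm) module_scheme \<Rightarrow>
     'k \<Rightarrow> 'a \<Rightarrow> ('k \<times> 'a \<Rightarrow>\<^sub>0 int) set"
  where "pure_tensor L K A c x = tensor_class L K A (frag_of (c, x))"

text \<open>The additive extensions of \<open>d (c, x) = (dc, x)\<close> and of
  \<open>(c, x) (d, y) = (cd, xy)\<close> to the free abelian group.\<close>

definition frag_smult ::
    "('k, 'r) ring_scheme \<Rightarrow> 'k \<Rightarrow> ('k \<times> 'a \<Rightarrow>\<^sub>0 int) \<Rightarrow> ('k \<times> 'a \<Rightarrow>\<^sub>0 int)"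
  where "frag_smult L d = frag_extend (\<lambda>(c, x). frag_of (d \<otimes>\<^bsub>L\<^esub> c, x))"

definition frag_mult ::
    "('k, 'r) ring_scheme \<Rightarrow> ('k, 'a, 'm) module_scheme \<Rightarrow>
     ('k \<times> 'a \<Rightarrow>\<^sub>0 int) \<Rightarrow> ('k \<times> 'a \<Rightarrow>\<^sub>0 int) \<Rightarrow> ('k \<times> 'a \<Rightarrow>\<^sub>0 int)"
  where "frag_mult L A p q =
    frag_extend (\<lambda>(c, x). frag_extend (\<lambda>(d, y). frag_of (c \<otimes>\<^bsub>L\<^esub> d, x \<otimes>\<^bsub>A\<^esub> y)) q) p"

text \<open>The operations are induced from representatives. Each union is over sets that all
  coincide, because the operations respect the relations.\<close>

definition scalar_extension ::
    "('k, 'r) ring_scheme \<Rightarrow> 'k set \<Rightarrow> ('k, 'a, 'm) module_scheme \<Rightarrow>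
     ('k, ('k \<times> 'a \<Rightarrow>\<^sub>0 int) set) module"
  where "scalar_extension L K A =
    \<lparr>carrier = carrier (tensor_group L K A),
     monoid.mult = (\<lambda>U V. \<Union>p \<in> U. \<Union>q \<in> V. tensor_class L K A (frag_mult L A p q)),
     one = pure_tensor L K A \<one>\<^bsub>L\<^esub> \<one>\<^bsub>A\<^esub>,
     ring.zero = \<one>\<^bsub>tensor_group L K A\<^esub>,
     ring.add = monoid.mult (tensor_group L K A),
     smult = (\<lambda>d U. \<Union>p \<in> U. tensor_class L K A (frag_smult L d p))\<rparr>"

section \<open>Fusion laws and axial algebras\<close>

record 'k fusion_law =
  eigenvalues :: "'k set"
  fuse :: "'k \<Rightarrow> 'k \<Rightarrow> 'k set"

definition is_fusion_law :: "'k fusion_law \<Rightarrow> bool"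
  where "is_fusion_law \<L> \<longleftrightarrow>
    finite (eigenvalues \<L>) \<and>
    (\<forall>l \<in> eigenvalues \<L>. \<forall>m \<in> eigenvalues \<L>.
       fuse \<L> l m \<subseteq> eigenvalues \<L> \<and> fuse \<L> l m = fuse \<L> m l)"

text \<open>The values of \<^const>\<open>fuse\<close> outside the set of eigenvalues carry no meaning, so they
  are ignored in comparing fusion laws.\<close>

definition same_fusion_law :: "'k fusion_law \<Rightarrow> 'k fusion_law \<Rightarrow> bool"
  where "same_fusion_law \<L> \<M> \<longleftrightarrow>
    eigenvalues \<L> = eigenvalues \<M> \<and>
    (\<forall>l \<in> eigenvalues \<L>. \<forall>m \<in> eigenvalues \<L>. fuse \<L> l m = fuse \<M> l m)"

definition eigenspace :: "('k, 'a, 'm) module_scheme \<Rightarrow> 'a \<Rightarrow> 'k \<Rightarrow> 'a set"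
  where "eigenspace M x l = {y \<in> carrier M. x \<otimes>\<^bsub>M\<^esub> y = l \<odot>\<^bsub>M\<^esub> y}"

text \<open>The sum of the eigenspaces of \<open>x\<close> for the eigenvalues in a finite set \<open>T\<close>. It is
  automatically direct, since eigenspaces for distinct eigenvalues are independent; it is the
  zero space for empty \<open>T\<close>.\<close>

definition eigenspace_sum :: "('k, 'a, 'm) module_scheme \<Rightarrow> 'a \<Rightarrow> 'k set \<Rightarrow> 'a set"
  where "eigenspace_sum M x T = {finsum M f T | f. \<forall>l \<in> T. f l \<in> eigenspace M x l}"

definition is_axis :: "('k, 'a, 'm) module_scheme \<Rightarrow> 'k fusion_law \<Rightarrow> 'a \<Rightarrow> bool"
  where "is_axis M \<L> x \<longleftrightarrow>
    x \<in> carrier M \<and> x \<otimes>\<^bsub>M\<^esub> x = x \<and>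
    eigenspace_sum M x (eigenvalues \<L>) = carrier M \<and>
    (\<forall>l \<in> eigenvalues \<L>. \<forall>m \<in> eigenvalues \<L>.
       \<forall>y \<in> eigenspace M x l. \<forall>z \<in> eigenspace M x m.
         y \<otimes>\<^bsub>M\<^esub> z \<in> eigenspace_sum M x (fuse \<L> l m))"

definition axial_algebra ::
    "('k, 'r) ring_scheme \<Rightarrow> ('k, 'a, 'm) module_scheme \<Rightarrow> 'a set \<Rightarrow> 'k fusion_law \<Rightarrow> bool"
  where "axial_algebra R M S \<L> \<longleftrightarrow>
    comm_nonassoc_algebra R M \<and> is_fusion_law \<L> \<and> eigenvalues \<L> \<subseteq> carrier R \<and>
    generates R M S \<and> (\<forall>x \<in> S. is_axis M \<L> x)"

section \<open>The algebras \<open>D(\<beta>)\<close> and the two fusion laws\<close>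

text \<open>The pair \<open>(s, t)\<close> stands for \<open>s e\<^sub>1 + t e\<^sub>2\<close>; the product is the bilinear extension of
  \<open>e\<^sub>1\<^sup>2 = e\<^sub>1\<close>, \<open>e\<^sub>1 e\<^sub>2 = e\<^sub>2 e\<^sub>1 = \<beta> e\<^sub>2\<close>, \<open>e\<^sub>2\<^sup>2 = e\<^sub>2\<close>.\<close>

definition D :: "complex \<Rightarrow> (complex, complex \<times> complex) module"
  where "D \<beta> =
    \<lparr>carrier = UNIV,
     monoid.mult = (\<lambda>(s, t) (s', t'). (s * s', \<beta> * (s * t' + t * s') + t * t')),
     one = undefined,
     ring.zero = (0, 0),
     ring.add = (\<lambda>(s, t) (s', t'). (s + s', t + t')),
     smult = (\<lambda>c (s, t). (c * s, c * t))\<rparr>"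

definition e1 :: "complex \<times> complex" where "e1 = (1, 0)"

definition e2 :: "complex \<times> complex" where "e2 = (0, 1)"

definition a6 :: "complex \<Rightarrow> complex \<times> complex"
  where "a6 \<beta> = e1 \<oplus>\<^bsub>D \<beta>\<^esub> ((1 - 2 * \<beta>) \<odot>\<^bsub>D \<beta>\<^esub> e2)"

definition star_law :: "complex fusion_law"
  where "star_law =
    \<lparr>eigenvalues = {0, 1, 2},
     fuse = (\<lambda>l m.
       if (l, m) = (0, 0) then {0, 1}
       else if (l, m) = (1, 1) then {1}
       else if (l, m) \<in> {(1, 2), (2, 1)} then {2}
       else if (l, m) = (2, 2) then {2}
       else {})\<rparr>"

text \<open>The fusion law \<open>F\<^bsub>D3\<^esub>\<close> of \<open>D(\<beta>)\<close> at \<open>\<beta> = -1\<close>, where its eigenvalues \<open>1\<close>, \<open>1 - \<beta>\<close>, \<open>0\<close>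
  are \<open>1\<close>, \<open>2\<close>, \<open>0\<close>.\<close>

definition F_D3_at_minus_1 :: "complex fusion_law"
  where "F_D3_at_minus_1 =
    \<lparr>eigenvalues = {1, 2, 0},
     fuse = (\<lambda>l m.
       if l = 1 \<and> m = 1 then {1}
       else if l = 1 \<and> m = 2 \<or> l = 2 \<and> m = 1 then {2}
       else if l = 2 \<and> m = 2 then {2}
       else if l = 0 \<and> m = 0 then {0, 1}
       else {})\<rparr>"

end

theory Submission
  imports Defs
begin

text \<open>A commutative algebra over \<open>F\<close> with basis \<open>a, b\<close> and products \<open>a\<^sup>2 = a\<close>, \<open>ab = \<beta> b\<close>,
  \<open>b\<^sup>2 = b\<close> becomes \<open>D(\<beta>)\<close> after extension of scalars, with \<open>a\<close> and \<open>b\<close> going to \<open>e\<^sub>1\<close> and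
  \<open>e\<^sub>2\<close>: the coordinates of pure tensors extend additively to the free abelian group, and modulo
  the tensor relations every element reduces to some \<open>(c, a) + (d, b)\<close>, so the elements with zero
  coordinates are exactly the tensor kernel. Hence the given algebra extends to \<open>D(2)\<close>. On the other
  hand \<open>a\<^sub>6 e\<^sub>2 = (1 - \<beta>) e\<^sub>2\<close> in \<open>D(\<beta>)\<close>, so \<open>e\<^sub>1 \<mapsto> a\<^sub>6\<close>, \<open>e\<^sub>2 \<mapsto> e\<^sub>2\<close> is an isomorphism
  from \<open>D(1 - \<beta>)\<close> to \<open>D(\<beta>)\<close>; for \<open>\<beta> = -1\<close> its domain is \<open>D(2)\<close>. For \<open>\<beta> = 2\<close> the
  eigenspaces of \<open>a\<close> are \<open>\<langle>a\<rangle>\<close> (1) and \<open>\<langle>b\<rangle>\<close> (2), those of \<open>b\<close> are \<open>\<langle>b\<rangle>\<close> (1) and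
  \<open>\<langle>a - 2b\<rangle>\<close> (0).\<close>

section \<open>The complex field, the algebras \<open>D \<beta>\<close>, and the fusion law\<close>

lemma complex_field_simps [simp]:
  "carrier complex_field = UNIV"
  "x \<otimes>\<^bsub>complex_field\<^esub> y = x * y"
  "x \<oplus>\<^bsub>complex_field\<^esub> y = x + y"
  "\<one>\<^bsub>complex_field\<^esub> = 1"
  "\<zero>\<^bsub>complex_field\<^esub> = 0"
  by (simp_all add: complex_field_def)

text \<open>Lets everything shown over a subfield \<open>F\<close> specialise to
  \<open>F = UNIV\<close>, as is done for \<open>D (-1)\<close>.\<close>

lemma carrier_update_complex_field [simp]: "complex_field\<lparr>carrier := UNIV\<rparr> = complex_field"
  by (simp add: complex_field_def)

lemma cring_complex_field: "cring complex_field"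
proof (rule cringI)
  show "abelian_group complex_field"
    by (rule abelian_groupI) (auto simp: algebra_simps intro: exI[of _ "- x" for x])
  show "Group.comm_monoid complex_field"
    by (rule comm_monoidI) (auto simp: algebra_simps)
qed (auto simp: algebra_simps)

lemma field_complex_field: "field complex_field"
proof (rule cring.cring_fieldI2[OF cring_complex_field])
  fix x assume "x \<in> carrier complex_field" "x \<noteq> \<zero>\<^bsub>complex_field\<^esub>"
  then show "\<exists>y\<in>carrier complex_field. x \<otimes>\<^bsub>complex_field\<^esub> y = \<one>\<^bsub>complex_field\<^esub>"
    by (auto intro: exI[of _ "inverse x"])
qed auto

lemma D_simps [simp]:
  "carrier (D \<beta>) = UNIV"
  "(s, t) \<otimes>\<^bsub>D \<beta>\<^esub> (s', t') = (s * s', \<beta> * (s * t' + t * s') + t * t')"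
  "(s, t) \<oplus>\<^bsub>D \<beta>\<^esub> (s', t') = (s + s', t + t')"
  "c \<odot>\<^bsub>D \<beta>\<^esub> (s, t) = (c * s, c * t)"
  "\<zero>\<^bsub>D \<beta>\<^esub> = (0, 0)"
  by (simp_all add: D_def)

lemma a6_eq: "a6 \<beta> = (1, 1 - 2 * \<beta>)"
  by (simp add: a6_def e1_def e2_def)

lemma comm_nonassoc_algebra_D: "comm_nonassoc_algebra complex_field (D \<beta>)"
proof -
  have "abelian_group (D \<beta>)"
  proof (rule abelian_groupI)
    fix x assume "x \<in> carrier (D \<beta>)"
    then show "\<exists>y\<in>carrier (D \<beta>). y \<oplus>\<^bsub>D \<beta>\<^esub> x = \<zero>\<^bsub>D \<beta>\<^esub>"
      by (cases x) (auto intro: exI[of _ "- fst x"] exI[of _ "- snd x"])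
  qed (auto simp: algebra_simps)
  then have "module complex_field (D \<beta>)"
    by (intro moduleI cring_complex_field) (auto simp: algebra_simps)
  then show ?thesis
    by (intro comm_nonassoc_algebra.intro comm_nonassoc_algebra_axioms.intro field_complex_field)
      (auto simp: algebra_simps)
qed

lemma same_fusion_law_refl: "same_fusion_law \<L> \<L>"
  by (simp add: same_fusion_law_def)

text \<open>Both tables fall through to the empty set, so they agree on all arguments and not only
  on eigenvalues. Hence the records are equal and can be rewritten into each other.\<close>

lemma F_D3_at_minus_1_eq: "F_D3_at_minus_1 = star_law"
  by (auto simp: F_D3_at_minus_1_def star_law_def fun_eq_iff)

lemma is_fusion_law_star_law: "is_fusion_law star_law"
  by (auto simp: is_fusion_law_def star_law_def)

section \<open>Eigenspaces and their sums\<close>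

context comm_nonassoc_algebra
begin

lemma mult_r_distr:
  assumes "x \<in> carrier M" "y \<in> carrier M" "z \<in> carrier M"
  shows "z \<otimes>\<^bsub>M\<^esub> (x \<oplus>\<^bsub>M\<^esub> y) = z \<otimes>\<^bsub>M\<^esub> x \<oplus>\<^bsub>M\<^esub> z \<otimes>\<^bsub>M\<^esub> y"
  using assms mult_l_distr[of x y z] mult_comm[of z] by simp

lemma mult_smult_right:
  assumes "r \<in> carrier R" "x \<in> carrier M" "y \<in> carrier M"
  shows "x \<otimes>\<^bsub>M\<^esub> (r \<odot>\<^bsub>M\<^esub> y) = r \<odot>\<^bsub>M\<^esub> (x \<otimes>\<^bsub>M\<^esub> y)"
  using assms mult_smult[of r y x] mult_comm[of x] by simp

lemma zero_in_eigenspace: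
  assumes "x \<in> carrier M" "l \<in> carrier R"
  shows "\<zero>\<^bsub>M\<^esub> \<in> eigenspace M x l"
  \<comment> \<open>Writing zero as the scalar 0 times zero and pulling the scalar out shows that
    \<open>x\<close> annihilates zero.\<close>
  using mult_smult_right[of \<zero> x "\<zero>\<^bsub>M\<^esub>"] assms by (simp add: eigenspace_def mult_closed)

lemma eigenspace_add:
  assumes "x \<in> carrier M" "l \<in> carrier R" "u \<in> eigenspace M x l" "v \<in> eigenspace M x l"
  shows "u \<oplus>\<^bsub>M\<^esub> v \<in> eigenspace M x l"
  using assms by (simp add: eigenspace_def mult_r_distr smult_r_distr)

lemma eigenspace_sumI:
  "(\<And>l. l \<in> T \<Longrightarrow> f l \<in> eigenspace M x l) \<Longrightarrow> finsum M f T \<in> eigenspace_sum M x T"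
  by (auto simp: eigenspace_sum_def)

lemma eigenspace_sum_incl:
  assumes "x \<in> carrier M" "T \<subseteq> carrier R" "finite T" "l \<in> T" "y \<in> eigenspace M x l"
  shows "y \<in> eigenspace_sum M x T"
proof -
  have "y \<in> carrier M"
    using assms(5) by (simp add: eigenspace_def)
  \<comment> \<open>The witness family is \<open>y\<close> at \<open>l\<close> and zero at every
    other index; zero lies in every eigenspace.\<close>
  then have "finsum M (\<lambda>m. if l = m then y else \<zero>\<^bsub>M\<^esub>) T = y"
    using M.add.finprod_singleton[of l T "\<lambda>_. y"] assms(3,4) by simp
  moreover have "(if l = m then y else \<zero>\<^bsub>M\<^esub>) \<in> eigenspace M x m" if "m \<in> T" for m
    using that assms(1,2,5) zero_in_eigenspace[of x m] by (cases "l = m") (simp_all add: subset_iff)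
  ultimately show ?thesis
    using eigenspace_sumI[of T "\<lambda>m. if l = m then y else \<zero>\<^bsub>M\<^esub>" x] by simp
qed

lemma eigenspace_sum_zero:
  assumes "x \<in> carrier M" "T \<subseteq> carrier R"
  shows "\<zero>\<^bsub>M\<^esub> \<in> eigenspace_sum M x T"
proof -
  have "finsum M (\<lambda>_. \<zero>\<^bsub>M\<^esub>) T = \<zero>\<^bsub>M\<^esub>"
    by (rule M.add.finprod_one_eqI) simp
  then show ?thesis
    using assms zero_in_eigenspace eigenspace_sumI[of T "\<lambda>_. \<zero>\<^bsub>M\<^esub>" x] by (simp add: subset_iff)
qed

lemma eigenspace_sum_add:
  assumes "x \<in> carrier M" "T \<subseteq> carrier R"
    and "y \<in> eigenspace_sum M x T" "z \<in> eigenspace_sum M x T"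
  shows "y \<oplus>\<^bsub>M\<^esub> z \<in> eigenspace_sum M x T"
proof -
  obtain f g where fg: "y = finsum M f T" "\<forall>l\<in>T. f l \<in> eigenspace M x l"
      "z = finsum M g T" "\<forall>l\<in>T. g l \<in> eigenspace M x l"
    using assms by (auto simp: eigenspace_sum_def)
  then have "finsum M (\<lambda>l. f l \<oplus>\<^bsub>M\<^esub> g l) T = y \<oplus>\<^bsub>M\<^esub> z"
    by (auto simp: eigenspace_def intro!: M.finsum_addf)
  moreover have "f l \<oplus>\<^bsub>M\<^esub> g l \<in> eigenspace M x l" if "l \<in> T" for l
    using that fg assms(1,2) by (auto intro!: eigenspace_add)
  ultimately show ?thesis
    using eigenspace_sumI[of T "\<lambda>l. f l \<oplus>\<^bsub>M\<^esub> g l" x] by simp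
qed

lemma eigenspace_sum_subset: "eigenspace_sum M x T \<subseteq> carrier M"
  by (auto simp: eigenspace_sum_def eigenspace_def intro!: M.finsum_closed)

end

section \<open>Two-dimensional algebras with a basis of two idempotents\<close>

lemma field_carrier_complex_field_closed:
  assumes "field (complex_field\<lparr>carrier := F\<rparr>)"
  shows "0 \<in> F" "1 \<in> F"
    and "s \<in> F \<Longrightarrow> t \<in> F \<Longrightarrow> s + t \<in> F"
    and "s \<in> F \<Longrightarrow> t \<in> F \<Longrightarrow> s * t \<in> F"
    and "s \<in> F \<Longrightarrow> - s \<in> F"
proof -
  interpret R: field "complex_field\<lparr>carrier := F\<rparr>"
    by fact
  show "0 \<in> F" "1 \<in> F" "s \<in> F \<Longrightarrow> t \<in> F \<Longrightarrow> s + t \<in> F" "s \<in> F \<Longrightarrow> t \<in> F \<Longrightarrow> s * t \<in> F"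
    using R.zero_closed R.one_closed R.add.m_closed[of s t] R.m_closed[of s t] by simp_all
  show "- s \<in> F" if "s \<in> F"
  proof -
    \<comment> \<open>The negative taken in the restricted record is a priori only some element of
      \<open>F\<close>; uniqueness of complex negatives identifies it with
      \<open>- s\<close>.\<close>
    have "\<ominus>\<^bsub>complex_field\<lparr>carrier := F\<rparr>\<^esub> s \<in> F \<and> s + \<ominus>\<^bsub>complex_field\<lparr>carrier := F\<rparr>\<^esub> s = 0"
      using R.add.inv_closed[of s] R.r_neg[of s] that by simp
    then show ?thesis
      by (metis add_eq_0_iff)
  qed
qed

text \<open>Serves twice: for the given algebra \<open>A\<close> over \<open>F\<close>, and for
  \<open>D (-1)\<close> over all of \<complex> with \<open>a6 (-1)\<close> and \<open>e2\<close> in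
  the roles of \<open>a\<close> and \<open>b\<close>.\<close>

locale idempotent_pair_algebra =
  fixes F :: "complex set" and A :: "(complex, 'a, 'm) module_scheme"
    and a b :: 'a and \<beta> :: complex
  assumes alg: "comm_nonassoc_algebra (complex_field\<lparr>carrier := F\<rparr>) A"
    and basis: "basis_pair (complex_field\<lparr>carrier := F\<rparr>) A a b"
    and beta_in [simp]: "\<beta> \<in> F"
    and aa: "a \<otimes>\<^bsub>A\<^esub> a = a"
    and ab: "a \<otimes>\<^bsub>A\<^esub> b = \<beta> \<odot>\<^bsub>A\<^esub> b"
    and bb: "b \<otimes>\<^bsub>A\<^esub> b = b"
begin

sublocale alg: comm_nonassoc_algebra "complex_field\<lparr>carrier := F\<rparr>" A
  by (rule alg)

definition comb :: "complex \<Rightarrow> complex \<Rightarrow> 'a"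
  where "comb s t = (s \<odot>\<^bsub>A\<^esub> a) \<oplus>\<^bsub>A\<^esub> (t \<odot>\<^bsub>A\<^esub> b)"

lemma field_F: "field (complex_field\<lparr>carrier := F\<rparr>)"
  using alg by (simp add: comm_nonassoc_algebra_def)

lemmas in_F [simp] = field_carrier_complex_field_closed[OF field_F]

lemma numeral_in_F [simp]: "numeral n \<in> F"
proof -
  have "of_nat m \<in> F" for m by (induction m) auto
  from this[of "numeral n"] show ?thesis by simp
qed

lemma ab_carrier [simp]: "a \<in> carrier A" "b \<in> carrier A"
  using basis by (auto simp: basis_pair_def)

lemma smult_simps:
  "s \<in> F \<Longrightarrow> x \<in> carrier A \<Longrightarrow> s \<odot>\<^bsub>A\<^esub> x \<in> carrier A"
  "s \<in> F \<Longrightarrow> t \<in> F \<Longrightarrow> x \<in> carrier A \<Longrightarrow> (s + t) \<odot>\<^bsub>A\<^esub> x = s \<odot>\<^bsub>A\<^esub> x \<oplus>\<^bsub>A\<^esub> t \<odot>\<^bsub>A\<^esub> x"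
  "s \<in> F \<Longrightarrow> x \<in> carrier A \<Longrightarrow> y \<in> carrier A
     \<Longrightarrow> s \<odot>\<^bsub>A\<^esub> (x \<oplus>\<^bsub>A\<^esub> y) = s \<odot>\<^bsub>A\<^esub> x \<oplus>\<^bsub>A\<^esub> s \<odot>\<^bsub>A\<^esub> y"
  "s \<in> F \<Longrightarrow> t \<in> F \<Longrightarrow> x \<in> carrier A \<Longrightarrow> s \<odot>\<^bsub>A\<^esub> (t \<odot>\<^bsub>A\<^esub> x) = (s * t) \<odot>\<^bsub>A\<^esub> x"
  "x \<in> carrier A \<Longrightarrow> 1 \<odot>\<^bsub>A\<^esub> x = x"
  "x \<in> carrier A \<Longrightarrow> 0 \<odot>\<^bsub>A\<^esub> x = \<zero>\<^bsub>A\<^esub>"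
  using alg.smult_closed[of s x] alg.smult_l_distr[of s t x] alg.smult_r_distr[of s x y]
    alg.smult_assoc1[of s t x] alg.smult_one[of x] alg.smult_l_null[of x]
  by simp_all

lemma comb_closed [simp]: "s \<in> F \<Longrightarrow> t \<in> F \<Longrightarrow> comb s t \<in> carrier A"
  by (simp add: comb_def smult_simps)

lemma comb_exists:
  assumes "x \<in> carrier A"
  obtains s t where "s \<in> F" "t \<in> F" "x = comb s t"
  using assms basis unfolding basis_pair_def comb_def by fastforce

lemma comb_inject:
  assumes "s \<in> F" "t \<in> F" "s' \<in> F" "t' \<in> F"
  shows "comb s t = comb s' t' \<longleftrightarrow> s = s' \<and> t = t'"
proof
  assume eq: "comb s t = comb s' t'"
  have "\<exists>!p. p \<in> F \<times> F \<and> comb s t = comb (fst p) (snd p)"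
    using basis comb_closed[OF assms(1,2)] by (simp add: basis_pair_def comb_def)
  then have "(s, t) = (s', t')"
    using eq assms by (metis fst_conv mem_Sigma_iff snd_conv)
  then show "s = s' \<and> t = t'" by simp
qed auto

lemma comb_basis: "comb 1 0 = a" "comb 0 1 = b" "comb 0 0 = \<zero>\<^bsub>A\<^esub>"
  by (simp_all add: comb_def smult_simps)

lemma comb_add:
  assumes "s \<in> F" "t \<in> F" "s' \<in> F" "t' \<in> F"
  shows "comb s t \<oplus>\<^bsub>A\<^esub> comb s' t' = comb (s + s') (t + t')"
  using assms by (simp add: comb_def smult_simps alg.M.add.m_ac)

lemma comb_smult:
  "r \<in> F \<Longrightarrow> s \<in> F \<Longrightarrow> t \<in> F \<Longrightarrow> r \<odot>\<^bsub>A\<^esub> comb s t = comb (r * s) (r * t)"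
  by (simp add: comb_def smult_simps)

lemma mult_smult_simps:
  assumes "r \<in> F" "x \<in> carrier A" "y \<in> carrier A"
  shows "(r \<odot>\<^bsub>A\<^esub> x) \<otimes>\<^bsub>A\<^esub> y = r \<odot>\<^bsub>A\<^esub> (x \<otimes>\<^bsub>A\<^esub> y)"
    and "x \<otimes>\<^bsub>A\<^esub> (r \<odot>\<^bsub>A\<^esub> y) = r \<odot>\<^bsub>A\<^esub> (x \<otimes>\<^bsub>A\<^esub> y)"
  using assms alg.mult_smult[of r x y] alg.mult_smult_right[of r x y] by simp_all

text \<open>The resulting coefficients are those of the product in \<open>D \<beta>\<close>, which
  is why \<open>A\<close> is an \<open>F\<close>-form of \<open>D \<beta>\<close>.\<close>

lemma comb_mult:
  assumes "s \<in> F" "t \<in> F" "s' \<in> F" "t' \<in> F"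
  shows "comb s t \<otimes>\<^bsub>A\<^esub> comb s' t' = comb (s * s') (\<beta> * (s * t' + t * s') + t * t')"
proof -
  have ba: "b \<otimes>\<^bsub>A\<^esub> a = \<beta> \<odot>\<^bsub>A\<^esub> b"
    using alg.mult_comm[of b a] ab by simp
  show ?thesis
    using assms
    by (simp add: comb_def smult_simps mult_smult_simps alg.mult_l_distr alg.mult_r_distr
        aa ab ba bb algebra_simps alg.M.add.m_ac)
qed

text \<open>In coordinates, multiplication by \<open>a\<close> is diagonal with entries 1 and
  \<open>\<beta>\<close>.\<close>

lemma eigenspace_a_iff:
  assumes "l \<in> F" "s \<in> F" "t \<in> F"
  shows "comb s t \<in> eigenspace A a l \<longleftrightarrow> s = l * s \<and> \<beta> * t = l * t"
  using assms comb_mult[of 1 0 s t]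
  by (simp add: eigenspace_def comb_smult comb_inject comb_basis)

text \<open>In coordinates, multiplication by \<open>b\<close> maps \<open>(s, t)\<close> to
  \<open>(0, \<beta> * s + t)\<close>.\<close>

lemma eigenspace_b_iff:
  assumes "l \<in> F" "s \<in> F" "t \<in> F"
  shows "comb s t \<in> eigenspace A b l \<longleftrightarrow> l * s = 0 \<and> \<beta> * s + t = l * t"
  using assms comb_mult[of 0 1 s t]
  by (auto simp: eigenspace_def comb_smult comb_inject comb_basis)

text \<open>Linear spanning is enough: a submodule containing \<open>a\<close> and \<open>b\<close>
  contains every \<open>comb s t\<close>.\<close>

lemma generates: "generates (complex_field\<lparr>carrier := F\<rparr>) A {a, b}"
  unfolding generates_def
proof (intro conjI allI impI)
  fix B assume B: "nonassoc_subalgebra (complex_field\<lparr>carrier := F\<rparr>) A B \<and> {a, b} \<subseteq> B"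
  then have sub: "submodule B (complex_field\<lparr>carrier := F\<rparr>) A"
    by (simp add: nonassoc_subalgebra_def)
  have "comb s t \<in> B" if "s \<in> F" "t \<in> F" for s t
    unfolding comb_def using that B
    by (intro alg.submoduleE[OF sub]) auto
  then show "B = carrier A"
    using alg.submoduleE(1)[OF sub] comb_exists by blast
qed auto

end

section \<open>The axes\<close>

lemma eigenvalues_star_law [simp]: "eigenvalues star_law = {0, 1, 2}"
  by (simp add: star_law_def)

lemma fuse_star_law:
  "fuse star_law l m =
    (if l = 0 \<and> m = 0 then {0, 1} else if l = 1 \<and> m = 1 then {1}
     else if l = 2 \<and> m \<in> {1, 2} \<or> l = 1 \<and> m = 2 then {2} else {})"
  by (auto simp: star_law_def)

locale star_pair_algebra = idempotent_pair_algebra F A a b 2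
  for F :: "complex set" and A :: "(complex, 'a, 'm) module_scheme" and a b :: 'a
begin

text \<open>The relations \<open>aa = a\<close>, \<open>ab = 2b\<close>, \<open>bb = b\<close>
  between the eigenvectors \<open>a\<close> (for 1) and \<open>b\<close> (for 2) are exactly the
  rules for 1 and 2 in the law.\<close>

lemma is_axis_a: "is_axis A star_law a"
  unfolding is_axis_def
proof (intro conjI ballI)
  show "eigenspace_sum A a (eigenvalues star_law) = carrier A"
  proof (intro equalityI subsetI)
    fix x assume "x \<in> carrier A"
    then obtain s t where st: "s \<in> F" "t \<in> F" "x = comb s t"
      by (rule comb_exists)
    then have "comb s 0 \<in> eigenspace A a 1" "comb 0 t \<in> eigenspace A a 2"
      by (simp_all add: eigenspace_a_iff)
    then have "comb s 0 \<oplus>\<^bsub>A\<^esub> comb 0 t \<in> eigenspace_sum A a {0, 1, 2}"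
      by (auto intro!: alg.eigenspace_sum_add
          intro: alg.eigenspace_sum_incl[of _ _ 1] alg.eigenspace_sum_incl[of _ _ 2])
    then show "x \<in> eigenspace_sum A a (eigenvalues star_law)"
      using st by (simp add: comb_add)
  qed (use alg.eigenspace_sum_subset in blast)
next
  fix l m y z
  assume lm: "l \<in> eigenvalues star_law" "m \<in> eigenvalues star_law"
    and yz: "y \<in> eigenspace A a l" "z \<in> eigenspace A a m"
  have F: "l \<in> F" "m \<in> F" and T: "fuse star_law l m \<subseteq> F"
    using lm by (auto simp: fuse_star_law)
  have "y \<in> carrier A" "z \<in> carrier A"
    using yz by (auto simp: eigenspace_def)
  then obtain s t s' t' where st: "s \<in> F" "t \<in> F" "y = comb s t" "s' \<in> F" "t' \<in> F" "z = comb s' t'"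
    using comb_exists by metis
  have coeffs: "s = l * s" "2 * t = l * t" "s' = m * s'" "2 * t' = m * t'"
    using yz st F eigenspace_a_iff by blast+
  have prod: "y \<otimes>\<^bsub>A\<^esub> z = comb (s * s') (2 * (s * t' + t * s') + t * t')"
    using st by (simp add: comb_mult)
  consider "l = 0 \<or> m = 0" | "l = 1" "m = 1" | "l = 1" "m = 2" | "l = 2" "m = 1" | "l = 2" "m = 2"
    using lm by auto
  then show "y \<otimes>\<^bsub>A\<^esub> z \<in> eigenspace_sum A a (fuse star_law l m)"
  proof cases
    \<comment> \<open>\<open>a\<close> has no nonzero eigenvector for 0, so one factor vanishes.
      Zero lies in every eigenspace sum, including the empty one.\<close>
    case 1
    then have "y \<otimes>\<^bsub>A\<^esub> z = \<zero>\<^bsub>A\<^esub>"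
      using coeffs prod by (auto simp: comb_basis)
    then show ?thesis
      using T by (simp add: alg.eigenspace_sum_zero)
  qed (use coeffs st in \<open>auto simp: comb_mult fuse_star_law eigenspace_a_iff
       intro!: alg.eigenspace_sum_incl\<close>)
qed (simp_all add: aa)

lemma is_axis_b: "is_axis A star_law b"
  unfolding is_axis_def
proof (intro conjI ballI)
  show "eigenspace_sum A b (eigenvalues star_law) = carrier A"
  proof (intro equalityI subsetI)
    fix x assume "x \<in> carrier A"
    then obtain s t where st: "s \<in> F" "t \<in> F" "x = comb s t"
      by (rule comb_exists)
    \<comment> \<open>This is the decomposition \<open>s(a - 2b) + (t + 2s)b\<close>, with
      \<open>a - 2b\<close> spanning the kernel of multiplication by \<open>b\<close>.\<close>
    then have "comb s (- 2 * s) \<in> eigenspace A b 0" "comb 0 (t + 2 * s) \<in> eigenspace A b 1"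
      by (simp_all add: eigenspace_b_iff)
    then have "comb s (- 2 * s) \<oplus>\<^bsub>A\<^esub> comb 0 (t + 2 * s) \<in> eigenspace_sum A b {0, 1, 2}"
      by (auto intro!: alg.eigenspace_sum_add
          intro: alg.eigenspace_sum_incl[of _ _ 0] alg.eigenspace_sum_incl[of _ _ 1])
    then show "x \<in> eigenspace_sum A b (eigenvalues star_law)"
      using st by (simp add: comb_add)
  qed (use alg.eigenspace_sum_subset in blast)
next
  fix l m y z
  assume lm: "l \<in> eigenvalues star_law" "m \<in> eigenvalues star_law"
    and yz: "y \<in> eigenspace A b l" "z \<in> eigenspace A b m"
  have F: "l \<in> F" "m \<in> F" and T: "fuse star_law l m \<subseteq> F"
    using lm by (auto simp: fuse_star_law)
  have "y \<in> carrier A" "z \<in> carrier A"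
    using yz by (auto simp: eigenspace_def)
  then obtain s t s' t' where st: "s \<in> F" "t \<in> F" "y = comb s t" "s' \<in> F" "t' \<in> F" "z = comb s' t'"
    using comb_exists by metis
  have coeffs: "l * s = 0" "2 * s + t = l * t" "m * s' = 0" "2 * s' + t' = m * t'"
    using yz st F eigenspace_b_iff by blast+
  have prod: "y \<otimes>\<^bsub>A\<^esub> z = comb (s * s') (2 * (s * t' + t * s') + t * t')"
    using st by (simp add: comb_mult)
  \<comment> \<open>The third case collects the pairs whose fusion product is empty, so there the
    product has to be zero.\<close>
  consider "l = 0" "m = 0" | "l = 1" "m = 1" | "l = 2 \<or> m = 2 \<or> l = 0 \<and> m = 1 \<or> l = 1 \<and> m = 0"
    using lm by auto
  then show "y \<otimes>\<^bsub>A\<^esub> z \<in> eigenspace_sum A b (fuse star_law l m)"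
  proof cases
    case 1
    then have t: "t = - 2 * s" "t' = - 2 * s'"
      using coeffs by (simp_all add: eq_neg_iff_add_eq_0 add.commute)
    \<comment> \<open>Since \<open>(a - 2b)(a - 2b) = (a - 2b) - 2b\<close>, both eigenvalues in the
      product of 0 with 0 occur.\<close>
    have "y \<otimes>\<^bsub>A\<^esub> z = comb (s * s') (- 2 * (s * s')) \<oplus>\<^bsub>A\<^esub> comb 0 (- 2 * (s * s'))"
      unfolding prod t using st by (simp add: comb_add)
    moreover have "comb (s * s') (- 2 * (s * s')) \<in> eigenspace A b 0"
        "comb 0 (- 2 * (s * s')) \<in> eigenspace A b 1"
      using st by (simp_all add: eigenspace_b_iff)
    ultimately show ?thesis
      using 1 by (auto simp: fuse_star_law intro!: alg.eigenspace_sum_add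
          intro: alg.eigenspace_sum_incl[of _ _ 0] alg.eigenspace_sum_incl[of _ _ 1])
  next
    case 2
    then show ?thesis
      using coeffs st by (auto simp: comb_mult fuse_star_law eigenspace_b_iff
          intro!: alg.eigenspace_sum_incl)
  next
    case 3
    \<comment> \<open>An eigenvector of \<open>b\<close> for 2 is zero, and
      \<open>b(a - 2b) = 0\<close> settles the mixed products of 0 and 1.\<close>
    then have "s * s' = 0 \<and> 2 * (s * t' + t * s') + t * t' = 0"
      using coeffs by (auto simp: eq_neg_iff_add_eq_0[symmetric] algebra_simps)
    then have "y \<otimes>\<^bsub>A\<^esub> z = \<zero>\<^bsub>A\<^esub>"
      using prod comb_basis(3) by metis
    then show ?thesis
      using T by (simp add: alg.eigenspace_sum_zero)
  qed
qed (simp_all add: bb)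

lemma axial_algebra_star_law:
  "axial_algebra (complex_field\<lparr>carrier := F\<rparr>) A {a, b} star_law"
  using alg is_fusion_law_star_law generates is_axis_a is_axis_b
  by (auto simp: axial_algebra_def)

end

text \<open>Here \<open>a6 (-1) = e1 + 3 e2\<close> is idempotent and its product with
  \<open>e2\<close> is \<open>2 e2\<close>, so this pair obeys the relations of \<open>a\<close> and
  \<open>b\<close>, and the axis computations carry over.\<close>

lemma D_minus_1_star_pair: "star_pair_algebra UNIV (D (-1)) (a6 (-1)) e2"
proof (intro star_pair_algebra.intro idempotent_pair_algebra.intro)
  have "\<exists>!p. x = ((fst p \<odot>\<^bsub>D (-1)\<^esub> a6 (-1)) \<oplus>\<^bsub>D (-1)\<^esub> (snd p \<odot>\<^bsub>D (-1)\<^esub> e2))" for x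
  \<comment> \<open>Solves \<open>x = p * a6 (-1) + q * e2\<close>: the
    \<open>e1\<close>-coefficient gives \<open>p\<close>, and subtracting the \<open>3 p\<close>
    contributed by \<open>a6 (-1)\<close> gives \<open>q\<close>.\<close>
  proof (rule ex1I[of _ "(fst x, snd x - 3 * fst x)"])
    show "x = (fst (fst x, snd x - 3 * fst x) \<odot>\<^bsub>D (-1)\<^esub> a6 (-1))
        \<oplus>\<^bsub>D (-1)\<^esub> (snd (fst x, snd x - 3 * fst x) \<odot>\<^bsub>D (-1)\<^esub> e2)"
      by (cases x) (simp add: a6_eq e2_def)
  qed (auto simp: a6_eq e2_def)
  then show "basis_pair (complex_field\<lparr>carrier := UNIV\<rparr>) (D (-1)) (a6 (-1)) e2"
    by (simp add: basis_pair_def)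
qed (simp_all add: comm_nonassoc_algebra_D a6_eq e2_def)

section \<open>Scalar extension\<close>

lemma algebra_iso_trans:
  assumes "algebra_iso R M N \<phi>" "algebra_iso R N P \<psi>"
  shows "algebra_iso R M P (\<psi> \<circ> \<phi>)"
proof -
  have "\<phi> x \<in> carrier N" if "x \<in> carrier M" for x
    using assms(1) that by (auto simp: algebra_iso_def bij_betw_def)
  then show ?thesis
    using assms by (auto simp: algebra_iso_def intro: bij_betw_trans)
qed

text \<open>The map is \<open>(s, t) \<mapsto> s * a6 \<beta> + t * e2\<close> in
  coordinates.\<close>

lemma algebra_iso_D_reflect:
  "algebra_iso complex_field (D (1 - \<beta>)) (D \<beta>) (\<lambda>(s, t). (s, (1 - 2 * \<beta>) * s + t))"
proof -
  have "bij (\<lambda>(s, t). (s, (1 - 2 * \<beta>) * s + t))"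
    by (rule o_bij[where g = "\<lambda>(s, t). (s, t - (1 - 2 * \<beta>) * s)"]) (auto simp: fun_eq_iff)
  then show ?thesis
    by (auto simp: algebra_iso_def comm_nonassoc_algebra_D algebra_simps)
qed

text \<open>Each law is checked after applying the injective \<open>\<phi>\<close>, where it becomes
  a law of \<open>N\<close>. This avoids verifying the axioms on cosets of the tensor
  kernel.\<close>

lemma comm_nonassoc_algebra_pullback:
  assumes N: "comm_nonassoc_algebra R N"
    and bij: "bij_betw \<phi> (carrier M) (carrier N)"
    and closed: "\<zero>\<^bsub>M\<^esub> \<in> carrier M"
      "\<And>x y. x \<in> carrier M \<Longrightarrow> y \<in> carrier M \<Longrightarrow> x \<oplus>\<^bsub>M\<^esub> y \<in> carrier M"
      "\<And>x y. x \<in> carrier M \<Longrightarrow> y \<in> carrier M \<Longrightarrow> x \<otimes>\<^bsub>M\<^esub> y \<in> carrier M"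
      "\<And>r x. r \<in> carrier R \<Longrightarrow> x \<in> carrier M \<Longrightarrow> r \<odot>\<^bsub>M\<^esub> x \<in> carrier M"
    and hom: "\<phi> \<zero>\<^bsub>M\<^esub> = \<zero>\<^bsub>N\<^esub>"
      "\<And>x y. x \<in> carrier M \<Longrightarrow> y \<in> carrier M \<Longrightarrow> \<phi> (x \<oplus>\<^bsub>M\<^esub> y) = \<phi> x \<oplus>\<^bsub>N\<^esub> \<phi> y"
      "\<And>x y. x \<in> carrier M \<Longrightarrow> y \<in> carrier M \<Longrightarrow> \<phi> (x \<otimes>\<^bsub>M\<^esub> y) = \<phi> x \<otimes>\<^bsub>N\<^esub> \<phi> y"
      "\<And>r x. r \<in> carrier R \<Longrightarrow> x \<in> carrier M \<Longrightarrow> \<phi> (r \<odot>\<^bsub>M\<^esub> x) = r \<odot>\<^bsub>N\<^esub> \<phi> x"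
  shows "comm_nonassoc_algebra R M"
proof -
  interpret N: comm_nonassoc_algebra R N
    by (rule N)
  have R: "field R" "cring R"
    using N by (auto simp: comm_nonassoc_algebra_def module_def)
  have in_N: "\<phi> x \<in> carrier N" if "x \<in> carrier M" for x
    using bij that by (auto simp: bij_betw_def)
  have eqI: "x = y" if "\<phi> x = \<phi> y" "x \<in> carrier M" "y \<in> carrier M" for x y
    using bij that by (auto simp: bij_betw_def inj_on_def)
  have "abelian_group M"
  proof (rule abelian_groupI)
    fix x assume x: "x \<in> carrier M"
    then have "\<ominus>\<^bsub>N\<^esub> \<phi> x \<in> carrier N"
      using in_N by simp
    \<comment> \<open>Negatives in \<open>M\<close> come from surjectivity, as preimages of
      negatives in \<open>N\<close>.\<close>
    then obtain y where "y \<in> carrier M" "\<phi> y = \<ominus>\<^bsub>N\<^esub> \<phi> x"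
      using bij by (metis bij_betw_imp_surj_on imageE)
    then show "\<exists>y\<in>carrier M. y \<oplus>\<^bsub>M\<^esub> x = \<zero>\<^bsub>M\<^esub>"
      using x by (intro bexI[of _ y] eqI) (simp_all add: closed hom in_N N.M.l_neg)
  qed (auto intro!: eqI simp: closed hom in_N N.M.add.m_ac)
  have comm: "\<phi> x \<otimes>\<^bsub>N\<^esub> \<phi> y = \<phi> y \<otimes>\<^bsub>N\<^esub> \<phi> x" if "x \<in> carrier M" "y \<in> carrier M" for x y
    using that by (intro N.mult_comm in_N)
  have "module R M"
    using R(2) \<open>abelian_group M\<close>
    by (intro moduleI)
      (auto intro!: eqI simp: closed hom in_N N.smult_l_distr N.smult_r_distr N.smult_assoc1)
  then show ?thesis
    using R(1)
    by (intro comm_nonassoc_algebra.intro comm_nonassoc_algebra_axioms.intro)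
      (auto intro!: eqI simp: closed hom in_N N.mult_l_distr N.mult_smult intro: comm)
qed

section \<open>Additive extension of a map on generators, with values in a commutative ring\<close>

definition frag_eval :: "('k \<Rightarrow> 'c::comm_ring_1) \<Rightarrow> ('k \<Rightarrow>\<^sub>0 int) \<Rightarrow> 'c"
  where "frag_eval h p = (\<Sum>k\<in>Poly_Mapping.keys p. of_int (Poly_Mapping.lookup p k) * h k)"

text \<open>Supports can shrink under addition; this puts \<open>p\<close>, \<open>q\<close> and
  \<open>p + q\<close> over one common index set.\<close>

lemma frag_eval_superset:
  assumes "finite S" "Poly_Mapping.keys p \<subseteq> S"
  shows "frag_eval h p = (\<Sum>k\<in>S. of_int (Poly_Mapping.lookup p k) * h k)"
  unfolding frag_eval_def using assms
  by (intro sum.mono_neutral_left) (auto simp: in_keys_iff)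

lemma frag_eval_zero [simp]: "frag_eval h 0 = 0"
  by (simp add: frag_eval_def)

lemma frag_eval_of [simp]: "frag_eval h (frag_of k) = h k"
  by (simp add: frag_eval_def keys_frag_of)

lemma frag_eval_add: "frag_eval h (p + q) = frag_eval h p + frag_eval h q"
proof -
  let ?S = "Poly_Mapping.keys p \<union> Poly_Mapping.keys q"
  have "frag_eval h r = (\<Sum>k\<in>?S. of_int (Poly_Mapping.lookup r k) * h k)"
    if "r \<in> {p, q, p + q}" for r
    using that keys_add[of p q] by (intro frag_eval_superset) auto
  then show ?thesis
    by (simp add: lookup_add algebra_simps sum.distrib)
qed

lemma frag_eval_minus: "frag_eval h (- p) = - frag_eval h p"
  using frag_eval_add[of h p "- p"] by (simp add: eq_neg_iff_add_eq_0 add.commute)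

lemma frag_eval_diff: "frag_eval h (p - q) = frag_eval h p - frag_eval h q"
  using frag_eval_add[of h p "- q"] by (simp add: frag_eval_minus)

lemma frag_eval_cong:
  "(\<And>k. k \<in> Poly_Mapping.keys p \<Longrightarrow> g k = h k) \<Longrightarrow> frag_eval g p = frag_eval h p"
  by (simp add: frag_eval_def)

lemma frag_eval_mult_left: "frag_eval (\<lambda>k. c * h k) p = c * frag_eval h p"
  by (simp add: frag_eval_def sum_distrib_left mult.left_commute)

lemma frag_eval_mult_right: "frag_eval (\<lambda>k. h k * c) p = frag_eval h p * c"
  using frag_eval_mult_left[of c h p] by (simp add: mult.commute)

lemma frag_eval_plus: "frag_eval (\<lambda>k. g k + h k) p = frag_eval g p + frag_eval h p"
  by (simp add: frag_eval_def algebra_simps sum.distrib)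

text \<open>Both sides are additive in \<open>p\<close> and agree on generators.\<close>

lemma frag_eval_extend:
  "frag_eval h (frag_extend f p) = frag_eval (\<lambda>k. frag_eval h (f k)) p"
  by (induction p rule: frag_induction[OF subset_UNIV])
    (simp_all add: frag_eval_diff frag_extend_diff)

lemma keys_frag_extend_subset:
  assumes "Poly_Mapping.keys p \<subseteq> S" "\<And>k. k \<in> S \<Longrightarrow> Poly_Mapping.keys (f k) \<subseteq> T"
  shows "Poly_Mapping.keys (frag_extend f p) \<subseteq> T"
  using assms keys_frag_extend[of f p] by blast

section \<open>Coordinates on the free abelian group and the tensor kernel\<close>

context idempotent_pair_algebra
begin

definition coord :: "'a \<Rightarrow> complex \<times> complex"
  where "coord x = (THE p. p \<in> F \<times> F \<and> x = comb (fst p) (snd p))"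

lemma coord_comb [simp]: "s \<in> F \<Longrightarrow> t \<in> F \<Longrightarrow> coord (comb s t) = (s, t)"
  unfolding coord_def by (rule the_equality) (auto simp: comb_inject)

abbreviation L :: "complex ring" where "L \<equiv> complex_field"
abbreviation free :: "(complex \<times> 'a \<Rightarrow>\<^sub>0 int) set"
  where "free \<equiv> carrier (tensor_free L A)"
abbreviation K :: "(complex \<times> 'a \<Rightarrow>\<^sub>0 int) set" where "K \<equiv> tensor_kernel L F A"

text \<open>A generator \<open>(c, comb s t)\<close> is to represent the sum of the pure tensors of
  \<open>c * s\<close> with \<open>a\<close> and of \<open>c * t\<close> with \<open>b\<close>;
  \<open>coord1\<close> and \<open>coord2\<close> are these two coefficients.\<close>

definition coord1 :: "complex \<times> 'a \<Rightarrow> complex"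
  where "coord1 k = fst k * fst (coord (snd k))"

definition coord2 :: "complex \<times> 'a \<Rightarrow> complex"
  where "coord2 k = fst k * snd (coord (snd k))"

definition tensor_coord :: "(complex \<times> 'a \<Rightarrow>\<^sub>0 int) \<Rightarrow> complex \<times> complex"
  where "tensor_coord p = (frag_eval coord1 p, frag_eval coord2 p)"

lemma tensor_coord_of [simp]:
  "s \<in> F \<Longrightarrow> t \<in> F \<Longrightarrow> tensor_coord (frag_of (c, comb s t)) = (c * s, c * t)"
  by (simp add: tensor_coord_def coord1_def coord2_def)

lemma tensor_coord_add:
  "tensor_coord (p + q) =
    (fst (tensor_coord p) + fst (tensor_coord q), snd (tensor_coord p) + snd (tensor_coord q))"
  by (simp add: tensor_coord_def frag_eval_add)

lemma tensor_coord_diff: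
  "tensor_coord (p - q) =
    (fst (tensor_coord p) - fst (tensor_coord q), snd (tensor_coord p) - snd (tensor_coord q))"
  by (simp add: tensor_coord_def frag_eval_diff)

lemma free_closed:
  "0 \<in> free" "p \<in> free \<Longrightarrow> q \<in> free \<Longrightarrow> p + q \<in> free" "p \<in> free \<Longrightarrow> q \<in> free \<Longrightarrow> p - q \<in> free"
  "x \<in> carrier A \<Longrightarrow> frag_of (c, x) \<in> free"
  using keys_add[of p q] keys_diff[of p q] by (auto simp: tensor_free_def keys_frag_of)

text \<open>On generators the coordinates are additive in each argument and balanced over
  \<open>F\<close>, so they kill every defining relation.\<close>

lemma tensor_relations_sound:
  assumes "r \<in> tensor_relations L F A"
  shows "r \<in> free" "tensor_coord r = (0, 0)"
proof -
  consider c d x where "x \<in> carrier A" "r = frag_of (c + d, x) - frag_of (c, x) - frag_of (d, x)"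
    | c x y where "x \<in> carrier A" "y \<in> carrier A"
        "r = frag_of (c, x \<oplus>\<^bsub>A\<^esub> y) - frag_of (c, x) - frag_of (c, y)"
    | c k x where "k \<in> F" "x \<in> carrier A" "r = frag_of (c * k, x) - frag_of (c, k \<odot>\<^bsub>A\<^esub> x)"
    using assms by (auto simp: tensor_relations_def)
  then have "r \<in> free \<and> tensor_coord r = (0, 0)"
  proof cases
    case (1 c d x)
    obtain s t where "s \<in> F" "t \<in> F" "x = comb s t"
      using 1(1) by (rule comb_exists)
    then show ?thesis
      unfolding 1(2) by (simp add: free_closed tensor_coord_add tensor_coord_diff algebra_simps)
  next
    case (2 c x y)
    obtain s t s' t' where "s \<in> F" "t \<in> F" "x = comb s t" "s' \<in> F" "t' \<in> F" "y = comb s' t'"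
      using 2(1,2) comb_exists by metis
    then show ?thesis
      unfolding 2(3)
      by (simp add: free_closed tensor_coord_add tensor_coord_diff comb_add algebra_simps)
  next
    case (3 c k x)
    obtain s t where "s \<in> F" "t \<in> F" "x = comb s t"
      using 3(2) by (rule comb_exists)
    then show ?thesis
      using 3(1) unfolding 3(3)
      by (simp add: free_closed tensor_coord_add tensor_coord_diff comb_smult algebra_simps)
  qed
  then show "r \<in> free" "tensor_coord r = (0, 0)" by auto
qed

lemma comm_group_tensor_free: "comm_group (tensor_free L A)"
  by (simp add: tensor_free_def abelian_free_Abelian_group)

lemma subgroup_K: "subgroup K (tensor_free L A)"
  unfolding tensor_kernel_def
  using tensor_relations_sound(1) comm_group_tensor_free
  by (intro group.generate_is_subgroup) (auto simp: comm_group_def)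

lemma K_closed:
  "0 \<in> K" "p \<in> K \<Longrightarrow> q \<in> K \<Longrightarrow> p + q \<in> K" "p \<in> K \<Longrightarrow> q \<in> K \<Longrightarrow> p - q \<in> K"
proof -
  show "0 \<in> K"
    using subgroup.one_closed[OF subgroup_K] by (simp add: tensor_free_def)
  show add: "p + q \<in> K" if "p \<in> K" "q \<in> K" for p q
    using subgroup.m_closed[OF subgroup_K that] by (simp add: tensor_free_def)
  have "- q \<in> K" if "q \<in> K"
    using subgroup.m_inv_closed[OF subgroup_K that] subgroup.mem_carrier[OF subgroup_K that]
    by (simp add: tensor_free_def)
  then show "p - q \<in> K" if "p \<in> K" "q \<in> K"
    using add[of p "- q"] that by simp
qed

lemma K_sound:
  assumes "p \<in> K"
  shows "tensor_coord p = (0, 0)"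
  using assms unfolding tensor_kernel_def
proof induction
  case one
  then show ?case by (simp add: tensor_free_def tensor_coord_def)
next
  case (incl h)
  then show ?case by (rule tensor_relations_sound)
next
  case (inv h)
  then have "inv\<^bsub>tensor_free L A\<^esub> h = - h"
    using tensor_relations_sound(1) by (simp add: tensor_free_def)
  then show ?case
    using tensor_relations_sound(2)[OF inv] by (simp add: tensor_coord_def frag_eval_minus)
next
  case (eng h1 h2)
  then show ?case by (simp add: tensor_free_def tensor_coord_add)
qed

lemma K_relations:
  "x \<in> carrier A \<Longrightarrow> frag_of (c + d, x) - frag_of (c, x) - frag_of (d, x) \<in> K"
  "x \<in> carrier A \<Longrightarrow> y \<in> carrier A \<Longrightarrow>
    frag_of (c, x \<oplus>\<^bsub>A\<^esub> y) - frag_of (c, x) - frag_of (c, y) \<in> K"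
  "k \<in> F \<Longrightarrow> x \<in> carrier A \<Longrightarrow> frag_of (c * k, x) - frag_of (c, k \<odot>\<^bsub>A\<^esub> x) \<in> K"
  unfolding tensor_kernel_def by (rule generate.incl; force simp: tensor_relations_def)+

text \<open>Additivity in the scalar for \<open>0 + 0\<close> yields the negative of this
  generator.\<close>

lemma K_zero_tensor: "x \<in> carrier A \<Longrightarrow> frag_of (0, x) \<in> K"
  using K_closed(3)[OF K_closed(1) K_relations(1)[of x 0 0]] by simp

text \<open>Split the second argument additively, then move \<open>s\<close> and \<open>t\<close>
  into the first one by balancing.\<close>

lemma K_pure_tensor:
  assumes "s \<in> F" "t \<in> F"
  shows "frag_of (c, comb s t) - frag_of (c * s, a) - frag_of (c * t, b) \<in> K"
proof -
  have "frag_of (c, comb s t) - frag_of (c, s \<odot>\<^bsub>A\<^esub> a) - frag_of (c, t \<odot>\<^bsub>A\<^esub> b) \<in> K"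
    unfolding comb_def using assms by (intro K_relations) (auto simp: smult_simps)
  moreover have "frag_of (c * s, a) - frag_of (c, s \<odot>\<^bsub>A\<^esub> a) \<in> K"
      "frag_of (c * t, b) - frag_of (c, t \<odot>\<^bsub>A\<^esub> b) \<in> K"
    using assms by (auto intro: K_relations)
  ultimately show ?thesis
    using K_closed(3)[OF K_closed(3)] by force
qed

text \<open>Induction over the free abelian group: generators are handled by
  \<open>K_pure_tensor\<close>, differences by additivity in the scalar.\<close>

lemma K_reduce:
  assumes "p \<in> free"
  shows "p - frag_of (fst (tensor_coord p), a) - frag_of (snd (tensor_coord p), b) \<in> K"
proof -
  have "Poly_Mapping.keys p \<subseteq> UNIV \<times> carrier A"
    using assms by (simp add: tensor_free_def)
  then show ?thesis
  proof (induction p rule: free_Abelian_group_induct[consumes 1, case_names zero diff gen])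
    \<comment> \<open>The generators \<open>frag_of (0, a)\<close> and \<open>frag_of (0, b)\<close>
      are nonzero in the free group and vanish only modulo \<open>K\<close>.\<close>
    case zero
    then show ?case
      using K_closed(3)[OF K_closed(3)[OF K_closed(1) K_zero_tensor[of a]] K_zero_tensor[of b]]
      by (simp add: tensor_coord_def)
  next
    case (diff p q)
    define cp dp where "cp = fst (tensor_coord p)" and "dp = snd (tensor_coord p)"
    define cq dq where "cq = fst (tensor_coord q)" and "dq = snd (tensor_coord q)"
    \<comment> \<open>Additivity applied to \<open>cp = (cp - cq) + cq\<close>, and likewise for the
      coefficients of \<open>b\<close>.\<close>
    have rel: "frag_of (cp, a) - frag_of (cp - cq, a) - frag_of (cq, a) \<in> K"
        "frag_of (dp, b) - frag_of (dp - dq, b) - frag_of (dq, b) \<in> K"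
      using K_relations(1)[of a "cp - cq" cq] K_relations(1)[of b "dp - dq" dq] by simp_all
    have IH: "p - frag_of (cp, a) - frag_of (dp, b) \<in> K" "q - frag_of (cq, a) - frag_of (dq, b) \<in> K"
      using diff by (simp_all add: cp_def dp_def cq_def dq_def)
    have "(p - frag_of (cp, a) - frag_of (dp, b)) - (q - frag_of (cq, a) - frag_of (dq, b))
        + (frag_of (cp, a) - frag_of (cp - cq, a) - frag_of (cq, a))
        + (frag_of (dp, b) - frag_of (dp - dq, b) - frag_of (dq, b)) \<in> K"
      by (rule K_closed(2)[OF K_closed(2)[OF K_closed(3)[OF IH] rel(1)] rel(2)])
    then show ?case
      by (simp add: tensor_coord_diff cp_def dp_def cq_def dq_def algebra_simps)
  next
    case (gen k)
    then obtain s t where "s \<in> F" "t \<in> F" "snd k = comb s t"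
      using comb_exists by (metis mem_Times_iff)
    then show ?case
      using K_pure_tensor[of s t "fst k"] by (cases k) simp
  qed
qed

text \<open>\<open>K_sound\<close> gives one inclusion; \<open>K_reduce\<close> at zero coordinates
  gives the other, up to two generators with scalar 0.\<close>

lemma K_iff: "p \<in> K \<longleftrightarrow> p \<in> free \<and> tensor_coord p = (0, 0)"
proof
  assume "p \<in> free \<and> tensor_coord p = (0, 0)"
  then have "p - frag_of (0, a) - frag_of (0, b) \<in> K"
    using K_reduce[of p] by simp
  then have "p - frag_of (0, a) - frag_of (0, b) + frag_of (0, b) + frag_of (0, a) \<in> K"
    using K_closed(2)[OF K_closed(2)] K_zero_tensor ab_carrier by blast
  then show "p \<in> K" by simp
qed (use K_sound subgroup.subset[OF subgroup_K] in blast)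

text \<open>Cosets of the kernel of an additive map are its fibres. Independence of representatives
  thereby becomes a comparison of coordinates.\<close>

lemma tensor_class_eq:
  assumes "p \<in> free"
  shows "tensor_class L F A p = {q \<in> free. tensor_coord q = tensor_coord p}"
proof -
  have G: "group (tensor_free L A)"
    using comm_group_tensor_free by (simp add: comm_group_def)
  have "q \<in> tensor_class L F A p \<longleftrightarrow> q - p \<in> K" if "q \<in> free" for q
    using subgroup.rcos_module[OF subgroup_K G assms that] assms that
    by (simp add: tensor_class_def tensor_free_def)
  moreover have "tensor_class L F A p \<subseteq> free"
    unfolding tensor_class_def
    using subgroup.elemrcos_carrier[OF subgroup_K G assms] by blast
  ultimately show ?thesis
    using assms free_closed(3)
    by (auto simp: K_iff tensor_coord_diff prod_eq_iff)
qed

lemma frag_smult_closed: "p \<in> free \<Longrightarrow> frag_smult L d p \<in> free"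
  unfolding frag_smult_def tensor_free_def carrier_free_Abelian_group_iff
  by (erule keys_frag_extend_subset) (auto simp: keys_frag_of)

lemma tensor_coord_smult: "tensor_coord (frag_smult L d p) = d \<odot>\<^bsub>D \<beta>\<^esub> tensor_coord p"
  by (simp add: tensor_coord_def frag_smult_def frag_eval_extend frag_eval_mult_left[symmetric]
      coord1_def coord2_def case_prod_unfold mult.assoc)

lemma frag_mult_closed: "p \<in> free \<Longrightarrow> q \<in> free \<Longrightarrow> frag_mult L A p q \<in> free"
  unfolding frag_mult_def tensor_free_def carrier_free_Abelian_group_iff case_prod_unfold
  by (rule keys_frag_extend_subset, assumption, rule keys_frag_extend_subset)
    (auto simp: keys_frag_of alg.mult_closed)

lemma coord_mult:
  assumes "k \<in> UNIV \<times> carrier A" "k' \<in> UNIV \<times> carrier A"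
  shows "coord1 (fst k * fst k', snd k \<otimes>\<^bsub>A\<^esub> snd k') = coord1 k * coord1 k'"
    and "coord2 (fst k * fst k', snd k \<otimes>\<^bsub>A\<^esub> snd k') =
      \<beta> * (coord1 k * coord2 k' + coord2 k * coord1 k') + coord2 k * coord2 k'"
proof -
  obtain s t s' t' where "s \<in> F" "t \<in> F" "snd k = comb s t" "s' \<in> F" "t' \<in> F" "snd k' = comb s' t'"
    using assms comb_exists by (metis mem_Times_iff)
  then show "coord1 (fst k * fst k', snd k \<otimes>\<^bsub>A\<^esub> snd k') = coord1 k * coord1 k'"
      "coord2 (fst k * fst k', snd k \<otimes>\<^bsub>A\<^esub> snd k') =
        \<beta> * (coord1 k * coord2 k' + coord2 k * coord1 k') + coord2 k * coord2 k'"
    by (simp_all add: coord1_def coord2_def comb_mult algebra_simps)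
qed

text \<open>Both sides are biadditive, so it suffices to compare pairs of generators, which is
  \<open>coord_mult\<close>.\<close>

lemma tensor_coord_mult:
  assumes "p \<in> free" "q \<in> free"
  shows "tensor_coord (frag_mult L A p q) = tensor_coord p \<otimes>\<^bsub>D \<beta>\<^esub> tensor_coord q"
proof -
  have keys: "Poly_Mapping.keys p \<subseteq> UNIV \<times> carrier A" "Poly_Mapping.keys q \<subseteq> UNIV \<times> carrier A"
    using assms by (simp_all add: tensor_free_def)
  \<comment> \<open>Only generators in the supports of \<open>p\<close> and \<open>q\<close> enter,
    so the formula for \<open>h\<close> is required just where \<open>coord\<close> is
    meaningful.\<close>
  have expand: "frag_eval h (frag_mult L A p q) = frag_eval (\<lambda>k. frag_eval (\<lambda>k'. g k k') q) p"
    if "\<And>k k'. k \<in> UNIV \<times> carrier A \<Longrightarrow> k' \<in> UNIV \<times> carrier A \<Longrightarrow>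
      h (fst k * fst k', snd k \<otimes>\<^bsub>A\<^esub> snd k') = g k k'"
    for h :: "complex \<times> 'a \<Rightarrow> complex" and g
    unfolding frag_mult_def frag_eval_extend case_prod_unfold frag_eval_of
    using keys that by (intro frag_eval_cong) (auto simp: subset_iff)
  have "frag_eval coord1 (frag_mult L A p q) =
      frag_eval (\<lambda>k. frag_eval (\<lambda>k'. coord1 k * coord1 k') q) p"
    by (rule expand) (rule coord_mult)
  moreover have "frag_eval coord2 (frag_mult L A p q) =
      frag_eval (\<lambda>k. frag_eval (\<lambda>k'.
        \<beta> * (coord1 k * coord2 k' + coord2 k * coord1 k') + coord2 k * coord2 k') q) p"
    by (rule expand) (rule coord_mult)
  ultimately show ?thesis
    by (simp add: tensor_coord_def frag_eval_plus frag_eval_mult_left frag_eval_mult_right)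
qed

section \<open>The scalar extension in coordinates\<close>

lemma carrier_scalar_extension:
  "carrier (scalar_extension L F A) = tensor_class L F A ` free"
  by (simp add: scalar_extension_def tensor_group_def carrier_FactGroup tensor_class_def image_def)

lemma tensor_class_cong:
  "p \<in> free \<Longrightarrow> q \<in> free \<Longrightarrow> tensor_coord p = tensor_coord q \<Longrightarrow>
    tensor_class L F A p = tensor_class L F A q"
  by (simp add: tensor_class_eq)

lemma tensor_class_self: "p \<in> free \<Longrightarrow> p \<in> tensor_class L F A p"
  by (simp add: tensor_class_eq)

text \<open>The unit of the quotient group is \<open>K\<close> itself, the fibre over
  \<open>(0, 0)\<close>.\<close>

lemma scalar_extension_zero: "\<zero>\<^bsub>scalar_extension L F A\<^esub> = tensor_class L F A 0"
  using K_iff tensor_class_eq[OF free_closed(1)]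
  by (auto simp: scalar_extension_def tensor_group_def tensor_coord_def)

lemma scalar_extension_add:
  assumes "p \<in> free" "q \<in> free"
  shows "tensor_class L F A p \<oplus>\<^bsub>scalar_extension L F A\<^esub> tensor_class L F A q =
    tensor_class L F A (p + q)"
proof -
  have "K \<lhd> tensor_free L A"
    using comm_group.subgroup_imp_normal[OF comm_group_tensor_free subgroup_K] .
  from normal.rcos_sum[OF this assms] show ?thesis
    by (simp add: scalar_extension_def tensor_group_def tensor_class_def tensor_free_def)
qed

text \<open>The coordinates of \<open>frag_mult\<close> depend only on those of the factors, so all
  sets in the defining union coincide; the union is over nonempty classes.\<close>

lemma scalar_extension_mult:
  assumes "p \<in> free" "q \<in> free"
  shows "tensor_class L F A p \<otimes>\<^bsub>scalar_extension L F A\<^esub> tensor_class L F A q =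
    tensor_class L F A (frag_mult L A p q)"
proof -
  have "tensor_class L F A p \<otimes>\<^bsub>scalar_extension L F A\<^esub> tensor_class L F A q =
      (\<Union>p' \<in> tensor_class L F A p. \<Union>q' \<in> tensor_class L F A q.
        tensor_class L F A (frag_mult L A p' q'))"
    by (simp add: scalar_extension_def)
  also have "\<dots> = (\<Union>p' \<in> tensor_class L F A p. \<Union>q' \<in> tensor_class L F A q.
        tensor_class L F A (frag_mult L A p q))"
    using assms
    by (intro SUP_cong refl tensor_class_cong)
      (simp_all add: tensor_class_eq frag_mult_closed tensor_coord_mult)
  also have "\<dots> = tensor_class L F A (frag_mult L A p q)"
    using tensor_class_self[OF assms(1)] tensor_class_self[OF assms(2)] by blast
  finally show ?thesis .
qed

lemma scalar_extension_smult:
  assumes "p \<in> free"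
  shows "d \<odot>\<^bsub>scalar_extension L F A\<^esub> tensor_class L F A p = tensor_class L F A (frag_smult L d p)"
proof -
  have "d \<odot>\<^bsub>scalar_extension L F A\<^esub> tensor_class L F A p =
      (\<Union>p' \<in> tensor_class L F A p. tensor_class L F A (frag_smult L d p'))"
    by (simp add: scalar_extension_def)
  also have "\<dots> = (\<Union>p' \<in> tensor_class L F A p. tensor_class L F A (frag_smult L d p))"
    using assms
    by (intro SUP_cong refl tensor_class_cong)
      (simp_all add: tensor_class_eq frag_smult_closed tensor_coord_smult)
  also have "\<dots> = tensor_class L F A (frag_smult L d p)"
    using tensor_class_self[OF assms] by blast
  finally show ?thesis .
qed

text \<open>The choice of representative is harmless, since coordinates are constant on each
  class.\<close>

definition scalar_extension_coord :: "(complex \<times> 'a \<Rightarrow>\<^sub>0 int) set \<Rightarrow> complex \<times> complex"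
  where "scalar_extension_coord U = tensor_coord (SOME p. p \<in> U)"

lemma scalar_extension_coord_class [simp]:
  assumes "p \<in> free"
  shows "scalar_extension_coord (tensor_class L F A p) = tensor_coord p"
proof -
  have "(SOME q. q \<in> tensor_class L F A p) \<in> tensor_class L F A p"
    by (rule someI[where P = "\<lambda>q. q \<in> _", OF tensor_class_self[OF assms]])
  then show ?thesis
    using assms by (simp add: scalar_extension_coord_def tensor_class_eq)
qed

lemma bij_scalar_extension_coord:
  "bij_betw scalar_extension_coord (carrier (scalar_extension L F A)) (carrier (D \<beta>))"
  unfolding bij_betw_def
proof
  show "inj_on scalar_extension_coord (carrier (scalar_extension L F A))"
  proof (rule inj_onI)
    fix U V
    assume UV: "U \<in> carrier (scalar_extension L F A)" "V \<in> carrier (scalar_extension L F A)"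
      and eq: "scalar_extension_coord U = scalar_extension_coord V"
    obtain p q where "p \<in> free" "U = tensor_class L F A p" "q \<in> free" "V = tensor_class L F A q"
      using UV unfolding carrier_scalar_extension by blast
    then show "U = V"
      using eq tensor_class_cong[of p q] by simp
  qed
  have "(c, d) \<in> scalar_extension_coord ` carrier (scalar_extension L F A)" for c d
  proof -
    \<comment> \<open>The preimage of \<open>(c, d)\<close> is the class of
      \<open>(c, a) + (d, b)\<close>; \<open>a\<close> and \<open>b\<close> are written through
      \<open>comb\<close> so that their coordinates can be read off.\<close>
    have "tensor_coord (frag_of (c, comb 1 0) + frag_of (d, comb 0 1)) = (c, d)"
      by (simp add: tensor_coord_add)
    moreover have "frag_of (c, comb 1 0) + frag_of (d, comb 0 1) \<in> free"
      by (intro free_closed comb_closed in_F)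
    ultimately show ?thesis
      unfolding carrier_scalar_extension by (metis imageI scalar_extension_coord_class)
  qed
  then show "scalar_extension_coord ` carrier (scalar_extension L F A) = carrier (D \<beta>)"
    by auto
qed

lemma algebra_iso_scalar_extension:
  "algebra_iso L (scalar_extension L F A) (D \<beta>) scalar_extension_coord"
proof -
  note ops = scalar_extension_zero scalar_extension_add scalar_extension_mult scalar_extension_smult
  have hom: "scalar_extension_coord \<zero>\<^bsub>scalar_extension L F A\<^esub> = \<zero>\<^bsub>D \<beta>\<^esub>"
    "\<And>x y. x \<in> carrier (scalar_extension L F A) \<Longrightarrow> y \<in> carrier (scalar_extension L F A) \<Longrightarrow>
      scalar_extension_coord (x \<oplus>\<^bsub>scalar_extension L F A\<^esub> y) =
      scalar_extension_coord x \<oplus>\<^bsub>D \<beta>\<^esub> scalar_extension_coord y"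
    "\<And>x y. x \<in> carrier (scalar_extension L F A) \<Longrightarrow> y \<in> carrier (scalar_extension L F A) \<Longrightarrow>
      scalar_extension_coord (x \<otimes>\<^bsub>scalar_extension L F A\<^esub> y) =
      scalar_extension_coord x \<otimes>\<^bsub>D \<beta>\<^esub> scalar_extension_coord y"
    "\<And>r x. r \<in> carrier L \<Longrightarrow> x \<in> carrier (scalar_extension L F A) \<Longrightarrow>
      scalar_extension_coord (r \<odot>\<^bsub>scalar_extension L F A\<^esub> x) =
      r \<odot>\<^bsub>D \<beta>\<^esub> scalar_extension_coord x"
    by (auto simp: carrier_scalar_extension ops free_closed frag_mult_closed frag_smult_closed
        tensor_coord_mult tensor_coord_smult)
      (simp_all add: tensor_coord_def frag_eval_add)
  \<comment> \<open>The algebra axioms are pulled back from \<open>D \<beta>\<close> along the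
    coordinate bijection.\<close>
  have "comm_nonassoc_algebra L (scalar_extension L F A)"
    by (rule comm_nonassoc_algebra_pullback[OF comm_nonassoc_algebra_D
          bij_scalar_extension_coord _ _ _ _ hom])
      (auto simp: carrier_scalar_extension ops
        intro!: imageI free_closed frag_mult_closed frag_smult_closed)
  then show ?thesis
    using hom bij_scalar_extension_coord by (simp add: algebra_iso_def comm_nonassoc_algebra_D)
qed

lemma scalar_extension_coord_pure_tensor:
  "scalar_extension_coord (pure_tensor L F A 1 a) = e1"
  "scalar_extension_coord (pure_tensor L F A 1 b) = e2"
  using tensor_coord_of[of 1 0 1] tensor_coord_of[of 0 1 1]
  by (simp_all add: pure_tensor_def free_closed comb_basis e1_def e2_def)

end

theorem proposition3p1:
  fixes F :: "complex set"
    and A :: "(complex, 'a) module"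
    and a b :: 'a
  assumes "subfield F complex_field"
    and "comm_nonassoc_algebra (complex_field\<lparr>carrier := F\<rparr>) A"
    and "basis_pair (complex_field\<lparr>carrier := F\<rparr>) A a b"
    and "a \<otimes>\<^bsub>A\<^esub> a = a"
    and "a \<otimes>\<^bsub>A\<^esub> b = 2 \<odot>\<^bsub>A\<^esub> b"
    and "b \<otimes>\<^bsub>A\<^esub> b = b"
  shows "axial_algebra (complex_field\<lparr>carrier := F\<rparr>) A {a, b} star_law
    \<and> axial_algebra complex_field (D (-1)) {e2, a6 (-1)} F_D3_at_minus_1
    \<and> (\<exists>\<phi>. algebra_iso complex_field (scalar_extension complex_field F A) (D (-1)) \<phi>
          \<and> \<phi> ` (pure_tensor complex_field F A 1 ` {a, b}) = {e2, a6 (-1)})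
    \<and> same_fusion_law star_law F_D3_at_minus_1"
proof -
  have "field (complex_field\<lparr>carrier := F\<rparr>)"
    using assms(2) by (simp add: comm_nonassoc_algebra_def)
  \<comment> \<open>The structure constant \<open>\<beta> = 2\<close> must be a scalar of
    \<open>F\<close>.\<close>
  from field_carrier_complex_field_closed(2,3)[OF this] have "1 + 1 \<in> F"
    by blast
  then interpret star_pair_algebra F A a b
    using assms by (intro star_pair_algebra.intro idempotent_pair_algebra.intro) simp_all
  have D: "axial_algebra complex_field (D (-1)) {e2, a6 (-1)} F_D3_at_minus_1"
    using star_pair_algebra.axial_algebra_star_law[OF D_minus_1_star_pair]
    by (simp add: F_D3_at_minus_1_eq insert_commute)
  \<comment> \<open>Coordinates lead to \<open>D 2\<close>, which is \<open>D (1 - \<beta>)\<close>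
    at \<open>\<beta> = -1\<close>, and the reflection then leads to \<open>D (-1)\<close>:
    \<open>a\<close> goes to \<open>e1\<close> and on to \<open>a6 (-1)\<close>, while
    \<open>b\<close> goes to \<open>e2\<close>, which stays fixed.\<close>
  define \<phi> where "\<phi> = (\<lambda>(s, t). (s, (1 - 2 * (-1)) * s + t)) \<circ> scalar_extension_coord"
  have "algebra_iso complex_field (scalar_extension complex_field F A) (D (-1)) \<phi>"
    unfolding \<phi>_def using algebra_iso_D_reflect[of "-1"]
    by (intro algebra_iso_trans[OF algebra_iso_scalar_extension]) simp
  moreover have "\<phi> ` (pure_tensor complex_field F A 1 ` {a, b}) = {e2, a6 (-1)}"
    by (auto simp: \<phi>_def scalar_extension_coord_pure_tensor a6_eq e1_def e2_def)
  ultimately show ?thesis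
    using axial_algebra_star_law D by (auto simp: F_D3_at_minus_1_eq same_fusion_law_refl)
qed

end
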